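(* Let $I=[a,b]\subset\mathbb{R}$ be a closed bounded interval ($a<b$). If $\varphi\in\Phi_{\mathrm w}(I)$, then $\mathrm{RBV}^\varphi_0(I)$, equipped with $\|\cdot\|_{\mathrm{RBV}^\varphi(I)}$, is a quasi-Banach space (a complete quasi-normed space).
   Context: $\Phi_{\mathrm w}(I)$ is the set of functions $\varphi:I\times[0,\infty)\to[0,\infty]$ such that: $x\mapsto\varphi(x,|g(x)|)$ is measurable for every measurable $g:I\to\mathbb{R}$; for every $x\in I$, $t\mapsto\varphi(x,t)$ is non-decreasing with $\varphi(x,0)=\lim_{t\to0^+}\varphi(x,t)=0$ and $\lim_{t\to\infty}\varphi(x,t)=\infty$; and there is $L\ge1$, independent of $x$, with $\frac{\varphi(x,s)}{s}\le L\frac{\varphi(x,t)}{t}$ for all $0<s<t$ and $x\in I$. For $A\subset I$ let $\varphi^+_A(t):=\sup_{x\in A}\varphi(x,t)$. A partition $(I_k)_{k=1}^n$ of $I$ is a finite family of non-degenerate closed intervals with disjoint interiors and union $I$. For $I_k=[a_k,b_k]$, $\Delta_kf:=f(a_k)-f(b_k)$. For $f:I\to\mathbb{R}$ (not assumed measurable), $$\mathrm V^\varphi_I(f):=\sup_{(I_k)}\sum_{k=1}^n\varphi^+_{I_k}\Big(\frac{|\Delta_kf|}{|I_k|}\Big)|I_k|,$$ the supremum being over all partitions of $I$. Further, $$\mathrm{RBV}^\varphi(I):=\{f:I\to\mathbb{R}\mid\lim_{\lambda\to0}\mathrm V^\varphi_I(\lambda f)=0\},\qquad \|f\|_{\mathrm{RBV}^\varphi(I)}:=\inf\{\lambda>0\mid\mathrm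 V^\varphi_I(f/\lambda)\le1\},$$ and $\mathrm{RBV}^\varphi_0(I):=\{f\in\mathrm{RBV}^\varphi(I)\mid f(a)=0\}$. A quasi-norm satisfies the axioms of a norm except that the triangle inequality is replaced by $\|f+g\|\le C(\|f\|+\|g\|)$ for some constant $C$. *)

theory Defs
  imports "HOL-Analysis.Analysis" "HOL-Library.Function_Algebras"
begin

definition Phi_w :: "real set \<Rightarrow> (real \<Rightarrow> real \<Rightarrow> ennreal) set" where
  "Phi_w I = {\<phi>.
     (\<forall>g :: real \<Rightarrow> real. g \<in> borel_measurable (lebesgue_on I) \<longrightarrow>
        (\<lambda>x. \<phi> x \<bar>g x\<bar>) \<in> borel_measurable (lebesgue_on I)) \<and>
     (\<forall>x\<in>I. mono_on {0..} (\<phi> x) \<and> \<phi> x 0 = 0 \<and>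
        (\<phi> x \<longlongrightarrow> 0) (at_right 0) \<and> (\<phi> x \<longlongrightarrow> \<infinity>) at_top) \<and>
     (\<exists>L::real. 1 \<le> L \<and> (\<forall>x\<in>I. \<forall>s t. 0 < s \<and> s < t \<longrightarrow>
        \<phi> x s / ennreal s \<le> ennreal L * (\<phi> x t / ennreal t)))}"

definition phi_sup :: "(real \<Rightarrow> real \<Rightarrow> ennreal) \<Rightarrow> real set \<Rightarrow> real \<Rightarrow> ennreal" where
  "phi_sup \<phi> A t = (SUP x\<in>A. \<phi> x t)"

text \<open>A partition is given as the set of its intervals: non-degenerate intervals with disjoint
  interiors are pairwise distinct, so no multiplicities are lost. Unlike partitions, the
  divisions of the library may contain degenerate intervals.\<close>
definition interval_partitions :: "real set \<Rightarrow> real set set set" where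
  "interval_partitions I = {P. P division_of I \<and> (\<forall>K\<in>P. interior K \<noteq> {})}"

definition Riesz_variation ::
  "(real \<Rightarrow> real \<Rightarrow> ennreal) \<Rightarrow> real set \<Rightarrow> (real \<Rightarrow> real) \<Rightarrow> ennreal" where
  "Riesz_variation \<phi> I f =
     (SUP P\<in>interval_partitions I. \<Sum>K\<in>P.
        phi_sup \<phi> K (\<bar>f (Inf K) - f (Sup K)\<bar> / measure lborel K) * ennreal (measure lborel K))"

text \<open>A function from \<open>I\<close> to the reals is represented by its extension by zero, so that equality
  and the pointwise operations on \<open>real \<Rightarrow> real\<close> are those of functions on \<open>I\<close>.\<close>
definition RBV :: "(real \<Rightarrow> real \<Rightarrow> ennreal) \<Rightarrow> real set \<Rightarrow> (real \<Rightarrow> real) set" where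
  "RBV \<phi> I = {f. (\<forall>x. x \<notin> I \<longrightarrow> f x = 0) \<and>
     ((\<lambda>c::real. Riesz_variation \<phi> I (\<lambda>x. c * f x)) \<longlongrightarrow> 0) (at 0)}"

text \<open>The infimum is taken in the reals; for \<open>f\<close> in \<open>RBV \<phi> I\<close> the set is nonempty.\<close>
definition RBV_norm ::
  "(real \<Rightarrow> real \<Rightarrow> ennreal) \<Rightarrow> real set \<Rightarrow> (real \<Rightarrow> real) \<Rightarrow> real" where
  "RBV_norm \<phi> I f = Inf {c::real. 0 < c \<and> Riesz_variation \<phi> I (\<lambda>x. f x / c) \<le> 1}"

definition RBV0 :: "(real \<Rightarrow> real \<Rightarrow> ennreal) \<Rightarrow> real \<Rightarrow> real \<Rightarrow> (real \<Rightarrow> real) set" where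
  "RBV0 \<phi> a b = {f \<in> RBV \<phi> {a..b}. f a = 0}"

locale quasi_normed_space = vector_space scale
  for scale :: "real \<Rightarrow> 'v::ab_group_add \<Rightarrow> 'v" +
  fixes V :: "'v set" and qnorm :: "'v \<Rightarrow> real"
  assumes subspace_carrier: "subspace V"
    and qnorm_nonneg: "f \<in> V \<Longrightarrow> 0 \<le> qnorm f"
    and qnorm_eq_0_iff: "f \<in> V \<Longrightarrow> qnorm f = 0 \<longleftrightarrow> f = 0"
    and qnorm_scale: "f \<in> V \<Longrightarrow> qnorm (scale c f) = \<bar>c\<bar> * qnorm f"
    and qnorm_quasi_triangle:
      "\<exists>C::real. \<forall>f\<in>V. \<forall>g\<in>V. qnorm (f + g) \<le> C * (qnorm f + qnorm g)"

locale quasi_Banach_space = quasi_normed_space +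
  assumes complete_carrier:
    "\<lbrakk>\<And>n. u n \<in> V;
      \<forall>e>0. \<exists>N::nat. \<forall>m\<ge>N. \<forall>n\<ge>N. qnorm (u m - u n) < e\<rbrakk>
     \<Longrightarrow> \<exists>l\<in>V. (\<lambda>n. qnorm (u n - l)) \<longlonglongrightarrow> 0"

end

(* The growth condition on \<phi> gives V (c f) \<le> L c V f for 0 \<le> c \<le> 1, while
   s + t \<le> 2 max s t gives V (f + g) \<le> V (2 f) + V (2 g); together they yield
   the quasi-triangle inequality with constant 2 L.  Testing V with the interval {a..y} bounds
   f y by a multiple (depending on y) of the quasi-norm, so Cauchy sequences converge pointwise.
   As \<phi> need not be left-continuous in its second argument, V is lower semicontinuous under
   pointwise convergence only after halving the limit, which is enough for norm convergence. *)

theory Submission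
  imports Defs
begin

text \<open>Fixing \<open>L\<close> as a parameter lets the constants of the later estimates, in
  particular the one in the quasi-triangle inequality, be written explicitly.\<close>

locale weak_Phi =
  fixes \<phi> :: "real \<Rightarrow> real \<Rightarrow> ennreal" and I :: "real set" and L :: real
  assumes mono: "\<lbrakk>x \<in> I; 0 \<le> s; s \<le> t\<rbrakk> \<Longrightarrow> \<phi> x s \<le> \<phi> x t"
    and zero: "x \<in> I \<Longrightarrow> \<phi> x 0 = 0"
    and at_top: "x \<in> I \<Longrightarrow> (\<phi> x \<longlongrightarrow> \<infinity>) at_top"
    and L_ge_1: "1 \<le> L"
    and growth: "\<lbrakk>x \<in> I; 0 < s; s < t\<rbrakk> \<Longrightarrow>
      \<phi> x s / ennreal s \<le> ennreal L * (\<phi> x t / ennreal t)"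

lemma Phi_w_imp_weak_Phi:
  assumes "\<phi> \<in> Phi_w I"
  obtains L where "weak_Phi \<phi> I L"
proof -
  obtain L :: real where "1 \<le> L"
    "\<forall>x\<in>I. \<forall>s t. 0 < s \<and> s < t \<longrightarrow> \<phi> x s / ennreal s \<le> ennreal L * (\<phi> x t / ennreal t)"
    using assms unfolding Phi_w_def by blast
  moreover have "mono_on {0..} (\<phi> x)" "\<phi> x 0 = 0" "(\<phi> x \<longlongrightarrow> \<infinity>) at_top" if "x \<in> I" for x
    using assms that unfolding Phi_w_def by blast+
  ultimately have "weak_Phi \<phi> I L"
    by unfold_locales (auto simp: mono_on_def)
  then show thesis ..
qed

section \<open>Growth estimates for \<open>\<phi>\<close> and its suprema over sets\<close>

context weak_Phi
begin

abbreviation V :: "(real \<Rightarrow> real) \<Rightarrow> ennreal" where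
  "V \<equiv> Riesz_variation \<phi> I"

text \<open>This is the growth condition between \<open>c * t\<close> and \<open>t\<close>,
  multiplied through by \<open>c * t\<close>. The boundary cases, where \<open>0 < c * t < t\<close>
  fails, follow from \<open>zero\<close> and \<open>1 \<le> L\<close>.\<close>

lemma growth_scale:
  assumes "x \<in> I" "0 \<le> c" "c \<le> 1" "0 \<le> t"
  shows "\<phi> x (c * t) \<le> ennreal (L * c) * \<phi> x t"
proof (cases "c = 0 \<or> t = 0 \<or> c = 1")
  case True
  have "1 * \<phi> x t \<le> ennreal L * \<phi> x t"
    using L_ge_1 by (intro mult_right_mono) auto
  with True show ?thesis using zero[OF \<open>x \<in> I\<close>] by auto
next
  case False
  then have pos: "0 < c" "c < 1" "0 < t" using assms by auto
  have cancel: "ennreal r * (z / ennreal r) = z" if "0 < r" for r z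
    using that ennreal_mult_divide_eq[of "ennreal r" z]
    by (simp add: ennreal_times_divide mult.commute[of "ennreal r"])
  have "\<phi> x (c * t) = ennreal (c * t) * (\<phi> x (c * t) / ennreal (c * t))"
    using pos by (simp add: cancel)
  also have "\<dots> \<le> ennreal (c * t) * (ennreal L * (\<phi> x t / ennreal t))"
    using pos \<open>x \<in> I\<close> by (intro mult_left_mono growth) auto
  also have "\<dots> = ennreal (L * c) * (ennreal t * (\<phi> x t / ennreal t))"
    using pos L_ge_1 by (simp add: ennreal_mult mult_ac)
  also have "ennreal t * (\<phi> x t / ennreal t) = \<phi> x t"
    using pos by (simp add: cancel)
  finally show ?thesis .
qed

lemma phi_sup_mono:
  assumes "K \<subseteq> I" "0 \<le> s" "s \<le> t"
  shows "phi_sup \<phi> K s \<le> phi_sup \<phi> K t"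
  unfolding phi_sup_def using assms by (intro SUP_mono) (auto intro: mono)

lemma phi_sup_zero: "K \<subseteq> I \<Longrightarrow> phi_sup \<phi> K 0 = 0"
  unfolding phi_sup_def by (intro antisym SUP_least) (auto simp: zero subset_iff)

text \<open>The constant \<open>L\<close> is uniform in \<open>x\<close>, so the pointwise estimate
  passes to the supremum.\<close>

lemma phi_sup_scale:
  assumes "K \<subseteq> I" "0 \<le> c" "c \<le> 1" "0 \<le> t"
  shows "phi_sup \<phi> K (c * t) \<le> ennreal (L * c) * phi_sup \<phi> K t"
  unfolding phi_sup_def
proof (rule SUP_least)
  fix x assume "x \<in> K"
  then have "\<phi> x (c * t) \<le> ennreal (L * c) * \<phi> x t" using assms growth_scale by auto
  also have "\<dots> \<le> ennreal (L * c) * (SUP x\<in>K. \<phi> x t)"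
    using \<open>x \<in> K\<close> by (intro mult_left_mono SUP_upper) auto
  finally show "\<phi> x (c * t) \<le> ennreal (L * c) * (SUP x\<in>K. \<phi> x t)" .
qed

text \<open>A substitute for convexity: \<open>r\<close> is at most twice the larger of
  \<open>s\<close> and \<open>t\<close>, so by monotonicity one of the two terms already
  dominates.\<close>

lemma phi_sup_add:
  assumes "K \<subseteq> I" "0 \<le> r" "r \<le> s + t" "0 \<le> s" "0 \<le> t"
  shows "phi_sup \<phi> K r \<le> phi_sup \<phi> K (2 * s) + phi_sup \<phi> K (2 * t)"
proof (cases "s \<le> t")
  case True
  with assms have "phi_sup \<phi> K r \<le> phi_sup \<phi> K (2 * t)" by (intro phi_sup_mono) auto
  then show ?thesis by (rule add_increasing[rotated]) simp
next
  case False
  with assms have "phi_sup \<phi> K r \<le> phi_sup \<phi> K (2 * s)" by (intro phi_sup_mono) auto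
  then show ?thesis by (rule add_increasing2[rotated]) simp
qed

section \<open>The variation functional under scaling, sums and limits\<close>

definition summand :: "(real \<Rightarrow> real) \<Rightarrow> real set \<Rightarrow> ennreal" where
  "summand f K = phi_sup \<phi> K (\<bar>f (Inf K) - f (Sup K)\<bar> / measure lborel K) * ennreal (measure lborel K)"

lemma summand_scale:
  "summand (\<lambda>x. c * f x) K =
    phi_sup \<phi> K (\<bar>c\<bar> * (\<bar>f (Inf K) - f (Sup K)\<bar> / measure lborel K)) * ennreal (measure lborel K)"
  by (simp add: summand_def abs_mult flip: right_diff_distrib)

lemma V_eq: "V f = (SUP P\<in>interval_partitions I. \<Sum>K\<in>P. summand f K)"
  by (simp add: Riesz_variation_def summand_def)

lemma interval_partitionsD:
  assumes "P \<in> interval_partitions I"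
  shows "finite P" "K \<in> P \<Longrightarrow> K \<subseteq> I"
  using assms division_ofD(1,2) unfolding interval_partitions_def by blast+

lemma V_leI:
  assumes "\<And>P. \<lbrakk>finite P; \<And>K. K \<in> P \<Longrightarrow> K \<subseteq> I; P \<in> interval_partitions I\<rbrakk> \<Longrightarrow>
    (\<Sum>K\<in>P. summand f K) \<le> B"
  shows "V f \<le> B"
  unfolding V_eq by (intro SUP_least assms) (auto dest: interval_partitionsD)

lemma V_upper: "P \<in> interval_partitions I \<Longrightarrow> (\<Sum>K\<in>P. summand f K) \<le> V f"
  unfolding V_eq by (rule SUP_upper)

lemma V_zero: "V (\<lambda>x. 0) = 0"
proof -
  have "V (\<lambda>x. 0) \<le> 0"
    by (rule V_leI) (simp add: summand_def phi_sup_zero)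
  then show ?thesis by simp
qed

text \<open>\<open>V\<close> sees a function only through the absolute values of its
  increments.\<close>

lemma V_abs: "V (\<lambda>x. \<bar>c\<bar> * f x) = V (\<lambda>x. c * f x)"
  by (simp add: Riesz_variation_def abs_mult flip: right_diff_distrib)

text \<open>The factor in \<open>phi_sup_scale\<close> is the same for every interval, so it can be
  pulled out of each partition sum. The resulting linear decay allows \<open>V\<close> to be made
  small by rescaling.\<close>

lemma V_scale:
  assumes "0 \<le> c" "c \<le> 1"
  shows "V (\<lambda>x. c * f x) \<le> ennreal (L * c) * V f"
proof (rule V_leI)
  fix P assume P: "finite P" "\<And>K. K \<in> P \<Longrightarrow> K \<subseteq> I" "P \<in> interval_partitions I"
  have "summand (\<lambda>x. c * f x) K \<le> ennreal (L * c) * summand f K" if "K \<in> P" for K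
    using phi_sup_scale[OF P(2)[OF that] assms, of "\<bar>f (Inf K) - f (Sup K)\<bar> / measure lborel K"] assms
    unfolding summand_def mult.assoc[symmetric]
    by (intro mult_right_mono) (simp_all add: abs_mult flip: right_diff_distrib)
  then have "(\<Sum>K\<in>P. summand (\<lambda>x. c * f x) K) \<le> ennreal (L * c) * (\<Sum>K\<in>P. summand f K)"
    unfolding sum_distrib_left by (rule sum_mono)
  also have "\<dots> \<le> ennreal (L * c) * V f"
    using P by (intro mult_left_mono V_upper) auto
  finally show "(\<Sum>K\<in>P. summand (\<lambda>x. c * f x) K) \<le> ennreal (L * c) * V f" .
qed

text \<open>Monotonicity of \<open>\<phi>\<close> alone gives this, hence without the factor
  \<open>L\<close> of \<open>V_scale\<close>; a bound by 1 is therefore preserved exactly.\<close>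

lemma V_mono_scale:
  assumes "0 \<le> c" "c \<le> d"
  shows "V (\<lambda>x. c * f x) \<le> V (\<lambda>x. d * f x)"
proof (rule V_leI)
  fix P assume P: "finite P" "\<And>K. K \<in> P \<Longrightarrow> K \<subseteq> I" "P \<in> interval_partitions I"
  have "summand (\<lambda>x. c * f x) K \<le> summand (\<lambda>x. d * f x) K" if "K \<in> P" for K
    unfolding summand_def using assms P(2)[OF that]
    by (intro mult_right_mono phi_sup_mono)
      (auto simp: abs_mult simp flip: right_diff_distrib intro!: divide_right_mono mult_right_mono)
  then have "(\<Sum>K\<in>P. summand (\<lambda>x. c * f x) K) \<le> (\<Sum>K\<in>P. summand (\<lambda>x. d * f x) K)"
    by (rule sum_mono)
  also have "\<dots> \<le> V (\<lambda>x. d * f x)" by (rule V_upper) fact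
  finally show "(\<Sum>K\<in>P. summand (\<lambda>x. c * f x) K) \<le> V (\<lambda>x. d * f x)" .
qed

lemma V_add: "V (\<lambda>x. f x + g x) \<le> V (\<lambda>x. 2 * f x) + V (\<lambda>x. 2 * g x)"
proof (rule V_leI)
  fix P assume P: "finite P" "\<And>K. K \<in> P \<Longrightarrow> K \<subseteq> I" "P \<in> interval_partitions I"
  have "summand (\<lambda>x. f x + g x) K \<le> summand (\<lambda>x. 2 * f x) K + summand (\<lambda>x. 2 * g x) K"
    if "K \<in> P" for K
  proof -
    let ?d = "\<lambda>f. \<bar>f (Inf K) - f (Sup K)\<bar> / measure lborel K"
    have "?d (\<lambda>x. f x + g x) \<le> ?d f + ?d g"
      unfolding add_divide_distrib[symmetric] by (rule divide_right_mono) auto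
    then have "phi_sup \<phi> K (?d (\<lambda>x. f x + g x)) \<le> phi_sup \<phi> K (2 * ?d f) + phi_sup \<phi> K (2 * ?d g)"
      using P(2)[OF that] by (intro phi_sup_add) auto
    then show ?thesis
      unfolding summand_scale unfolding summand_def distrib_right[symmetric]
      by (intro mult_right_mono) simp_all
  qed
  then have "(\<Sum>K\<in>P. summand (\<lambda>x. f x + g x) K) \<le>
      (\<Sum>K\<in>P. summand (\<lambda>x. 2 * f x) K) + (\<Sum>K\<in>P. summand (\<lambda>x. 2 * g x) K)"
    unfolding sum.distrib[symmetric] by (rule sum_mono)
  also have "\<dots> \<le> V (\<lambda>x. 2 * f x) + V (\<lambda>x. 2 * g x)"
    by (intro add_mono V_upper) fact+
  finally show "(\<Sum>K\<in>P. summand (\<lambda>x. f x + g x) K) \<le> V (\<lambda>x. 2 * f x) + V (\<lambda>x. 2 * g x)" .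
qed

lemma V_half_limit:
  assumes lim: "\<And>x. (\<lambda>n. u n x) \<longlonglongrightarrow> f x"
    and bound: "\<forall>\<^sub>F n in sequentially. V (u n) \<le> B"
  shows "V (\<lambda>x. f x / 2) \<le> B"
proof (rule V_leI)
  fix P assume P: "finite P" "\<And>K. K \<in> P \<Longrightarrow> K \<subseteq> I" "P \<in> interval_partitions I"
  \<comment> \<open>Halving a nonzero increment leaves a strict gap below the limit, so convergence
    at the two endpoints gives an eventual inequality between arguments of \<open>\<phi>\<close>, to
    which monotonicity applies. A zero increment is trivial.\<close>
  have ev: "\<forall>\<^sub>F n in sequentially. summand (\<lambda>x. f x / 2) K \<le> summand (u n) K" if "K \<in> P" for K
  proof -
    let ?d = "\<lambda>f. \<bar>f (Inf K) - f (Sup K)\<bar>"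
    have d: "?d (\<lambda>x. f x / 2) = ?d f / 2" by (simp flip: diff_divide_distrib)
    have "\<forall>\<^sub>F n in sequentially. ?d (\<lambda>x. f x / 2) \<le> ?d (u n)"
    proof (cases "?d f = 0")
      case False
      have "(\<lambda>n. ?d (u n)) \<longlonglongrightarrow> ?d f" by (intro tendsto_intros lim)
      moreover have "?d f / 2 < ?d f" using False by simp
      ultimately have "\<forall>\<^sub>F n in sequentially. ?d f / 2 < ?d (u n)" by (rule order_tendstoD)
      then show ?thesis unfolding d by (rule eventually_mono) simp
    qed (simp add: d)
    then show ?thesis
    proof (rule eventually_mono)
      fix n assume "?d (\<lambda>x. f x / 2) \<le> ?d (u n)"
      then show "summand (\<lambda>x. f x / 2) K \<le> summand (u n) K"
        unfolding summand_def using P(2)[OF that]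
        by (intro mult_right_mono phi_sup_mono divide_right_mono) auto
    qed
  qed
  have "\<forall>\<^sub>F n in sequentially. \<forall>K\<in>P. summand (\<lambda>x. f x / 2) K \<le> summand (u n) K"
    \<comment> \<open>\<open>P\<close> is finite, so one index serves all of its intervals.\<close>
    using P(1) ev by (intro eventually_ball_finite) auto
  with bound have "\<forall>\<^sub>F n in sequentially. (\<Sum>K\<in>P. summand (\<lambda>x. f x / 2) K) \<le> B"
  proof eventually_elim
    case (elim n)
    have "(\<Sum>K\<in>P. summand (\<lambda>x. f x / 2) K) \<le> (\<Sum>K\<in>P. summand (u n) K)"
      using elim by (intro sum_mono) auto
    also have "\<dots> \<le> V (u n)" by (rule V_upper) fact
    finally show ?case using elim by simp
  qed
  then show "(\<Sum>K\<in>P. summand (\<lambda>x. f x / 2) K) \<le> B" by simp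
qed

section \<open>Membership in \<open>RBV\<close> and the quasi-norm\<close>

lemma RBV_iff:
  "f \<in> RBV \<phi> I \<longleftrightarrow> (\<forall>x. x \<notin> I \<longrightarrow> f x = 0) \<and> (\<exists>c>0. V (\<lambda>x. f x / c) \<le> 1)"
proof -
  have "((\<lambda>c. V (\<lambda>x. c * f x)) \<longlongrightarrow> 0) (at 0) \<longleftrightarrow> (\<exists>c>0. V (\<lambda>x. f x / c) \<le> 1)" (is "?lim \<longleftrightarrow> ?ex")
  proof
    assume ?lim
    then have "\<forall>\<^sub>F c in at 0. V (\<lambda>x. c * f x) < 1" by (rule order_tendstoD) simp
    then obtain d where d: "d > 0" "\<And>c. \<lbrakk>c \<noteq> 0; \<bar>c\<bar> < d\<rbrakk> \<Longrightarrow> V (\<lambda>x. c * f x) < 1"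
      unfolding eventually_at by (auto simp: dist_real_def)
    \<comment> \<open>The point \<open>d / 2\<close> lies in the punctured neighbourhood, and
      multiplying by it is dividing by \<open>2 / d\<close>.\<close>
    then have "V (\<lambda>x. f x / (2 / d)) \<le> 1"
      using d(2)[of "d / 2"] by (simp add: mult.commute less_imp_le)
    then show ?ex using d(1) by (intro exI[of _ "2 / d"]) simp
  next
    assume ?ex
    then obtain d where d: "d > 0" "V (\<lambda>x. f x / d) \<le> 1" by auto
    \<comment> \<open>One finite bound forces linear decay: up to sign, \<open>c * f\<close> is
      \<open>\<bar>c\<bar> * d\<close> times \<open>f / d\<close>, and \<open>V_scale\<close>
      applies once that factor is at most 1.\<close>
    have upper: "V (\<lambda>x. c * f x) \<le> ennreal (L * (\<bar>c\<bar> * d))" if "\<bar>c\<bar> \<le> 1 / d" for c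
    proof -
      have "V (\<lambda>x. c * f x) = V (\<lambda>x. (\<bar>c\<bar> * d) * (f x / d))"
        using d V_abs[of c f] by (simp add: field_simps)
      also have "\<dots> \<le> ennreal (L * (\<bar>c\<bar> * d)) * V (\<lambda>x. f x / d)"
        using d that by (intro V_scale) (auto simp: field_simps)
      also have "\<dots> \<le> ennreal (L * (\<bar>c\<bar> * d)) * 1"
        using d by (intro mult_left_mono) auto
      finally show ?thesis by simp
    qed
    have "\<forall>\<^sub>F c in at 0. \<bar>c\<bar> \<le> 1 / d"
      unfolding eventually_at using d(1) by (intro exI[of _ "1 / d"]) auto
    then have le: "\<forall>\<^sub>F c in at 0. V (\<lambda>x. c * f x) \<le> ennreal (L * (\<bar>c\<bar> * d))"
      by (rule eventually_mono) (rule upper)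
    have "((\<lambda>c. ennreal (L * (\<bar>c\<bar> * d))) \<longlongrightarrow> ennreal (L * (\<bar>0\<bar> * d))) (at 0)"
      by (intro tendsto_ennrealI tendsto_intros)
    then have "((\<lambda>c. ennreal (L * (\<bar>c\<bar> * d))) \<longlongrightarrow> 0) (at 0)" by simp
    then show ?lim
      by (rule tendsto_sandwich[OF _ le tendsto_const, rotated]) simp
  qed
  then show ?thesis unfolding RBV_def by simp
qed

abbreviation N :: "(real \<Rightarrow> real) \<Rightarrow> real" where
  "N \<equiv> RBV_norm \<phi> I"

lemma RBV_norm_le: "\<lbrakk>0 < c; V (\<lambda>x. f x / c) \<le> 1\<rbrakk> \<Longrightarrow> N f \<le> c"
  unfolding RBV_norm_def by (intro cInf_lower) (auto intro: bdd_belowI[of _ 0])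

text \<open>Membership in \<open>RBV\<close> makes the set under the infimum nonempty, so its lower
  bound 0 passes to the infimum.\<close>

lemma RBV_norm_nonneg: "f \<in> RBV \<phi> I \<Longrightarrow> 0 \<le> N f"
  unfolding RBV_norm_def by (rule cInf_greatest) (auto simp: RBV_iff)

text \<open>The set defining the quasi-norm is upward closed by \<open>V_mono_scale\<close>, so it
  contains everything above its infimum. The infimum itself need not belong to it, since
  \<open>\<phi>\<close> may jump; hence the strict inequality.\<close>

lemma RBV_norm_less:
  assumes "f \<in> RBV \<phi> I" "N f < c"
  shows "V (\<lambda>x. f x / c) \<le> 1"
proof -
  have "{c. 0 < c \<and> V (\<lambda>x. f x / c) \<le> 1} \<noteq> {}"
    using assms(1) by (auto simp: RBV_iff)
  then obtain d where d: "0 < d" "V (\<lambda>x. f x / d) \<le> 1" "d < c"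
    using cInf_lessD[of "{c. 0 < c \<and> V (\<lambda>x. f x / c) \<le> 1}" c] assms(2)
    unfolding RBV_norm_def by auto
  have "V (\<lambda>x. (1 / c) * f x) \<le> V (\<lambda>x. (1 / d) * f x)"
    using d by (intro V_mono_scale) (auto simp: frac_le)
  then show ?thesis using d(2) by simp
qed

lemma RBV_norm_zero: "N (\<lambda>x. 0) = 0"
proof (rule antisym)
  show "N (\<lambda>x. 0) \<le> 0"
    by (rule field_le_epsilon) (auto intro!: RBV_norm_le simp: V_zero)
  show "0 \<le> N (\<lambda>x. 0)"
    by (rule RBV_norm_nonneg) (auto simp: RBV_iff V_zero intro!: exI[of _ 1])
qed

text \<open>The quotient equals \<open>sgn c * (f x / d)\<close>, and \<open>V\<close> ignores the
  sign.\<close>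

lemma V_scale_quotient:
  assumes "c \<noteq> 0"
  shows "V (\<lambda>x. c * f x / (\<bar>c\<bar> * d)) = V (\<lambda>x. f x / d)"
proof -
  have "V (\<lambda>x. c * f x / (\<bar>c\<bar> * d)) = V (\<lambda>x. sgn c * (f x / d))"
    using assms by (intro arg_cong[of _ _ V]) (auto simp: sgn_if fun_eq_iff)
  also have "\<dots> = V (\<lambda>x. f x / d)"
    using V_abs[of "sgn c" "\<lambda>x. f x / d"] assms by (simp add: abs_sgn_eq)
  finally show ?thesis .
qed

lemma RBV_scale:
  assumes "f \<in> RBV \<phi> I"
  shows "(\<lambda>x. c * f x) \<in> RBV \<phi> I"
proof (cases "c = 0")
  case True
  then show ?thesis by (auto simp: RBV_iff V_zero intro!: exI[of _ 1])
next
  case False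
  then show ?thesis
    using assms V_scale_quotient[OF False, of f] unfolding RBV_iff
    by (metis mult_eq_0_iff mult_pos_pos zero_less_abs_iff)
qed

lemma RBV_norm_scale_le:
  assumes "f \<in> RBV \<phi> I" "c \<noteq> 0"
  shows "N (\<lambda>x. c * f x) \<le> \<bar>c\<bar> * N f"
proof (rule field_le_epsilon)
  fix e :: real assume "0 < e"
  \<comment> \<open>Strictly above \<open>N f\<close>, and chosen so that
    \<open>\<bar>c\<bar> * d\<close> exceeds \<open>\<bar>c\<bar> * N f\<close> by exactly
    \<open>e\<close>.\<close>
  define d where "d = N f + e / \<bar>c\<bar>"
  have d: "N f < d" "0 < d"
    using \<open>0 < e\<close> assms RBV_norm_nonneg[OF assms(1)] by (auto simp: d_def add_nonneg_pos)
  have "N (\<lambda>x. c * f x) \<le> \<bar>c\<bar> * d"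
    using d assms RBV_norm_less[OF assms(1) d(1)] V_scale_quotient
    by (intro RBV_norm_le) auto
  then show "N (\<lambda>x. c * f x) \<le> \<bar>c\<bar> * N f + e"
    using assms(2) by (simp add: d_def distrib_left)
qed

text \<open>The reverse inequality is \<open>RBV_norm_scale_le\<close> applied to
  \<open>c * f\<close> with the factor \<open>inverse c\<close>.\<close>

lemma RBV_norm_scale:
  assumes "f \<in> RBV \<phi> I"
  shows "N (\<lambda>x. c * f x) = \<bar>c\<bar> * N f"
proof (cases "c = 0")
  case True
  then show ?thesis by (simp add: RBV_norm_zero)
next
  case False
  have "\<bar>c\<bar> * N f = \<bar>c\<bar> * N (\<lambda>x. inverse c * (c * f x))"
    using False by (simp add: mult.assoc[symmetric])
  also have "\<dots> \<le> \<bar>c\<bar> * (\<bar>inverse c\<bar> * N (\<lambda>x. c * f x))"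
    using False RBV_norm_scale_le[OF RBV_scale[OF assms, of c], of "inverse c"]
    by (intro mult_left_mono) auto
  also have "\<dots> = N (\<lambda>x. c * f x)" using False by (simp add: field_simps)
  finally show ?thesis using RBV_norm_scale_le[OF assms False] by simp
qed

lemma V_add_quotient:
  assumes "0 < s" "0 < t" "V (\<lambda>x. f x / s) \<le> 1" "V (\<lambda>x. g x / t) \<le> 1"
  shows "V (\<lambda>x. (f x + g x) / (2 * L * (s + t))) \<le> 1"
proof -
  \<comment> \<open>With this \<open>r\<close> the two contributions \<open>L * (2 * s / r)\<close>
    and \<open>L * (2 * t / r)\<close> add up to exactly 1.\<close>
  define r where "r = 2 * L * (s + t)"
  have r: "0 < r" using assms L_ge_1 by (simp add: r_def)
  have *: "V (\<lambda>x. 2 * (h x / r)) \<le> ennreal (L * (2 * d / r))"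
    if d: "0 < d" "d \<le> s + t" "V (\<lambda>x. h x / d) \<le> 1" for h d
  proof -
    \<comment> \<open>Here \<open>1 \<le> L\<close> ensures that the scaling factor
      \<open>2 * d / r\<close> is at most 1, as \<open>V_scale\<close> requires.\<close>
    have "1 * d \<le> L * (s + t)" using assms d L_ge_1 by (intro mult_mono) auto
    then have "2 * d \<le> r" by (simp add: r_def)
    have "V (\<lambda>x. 2 * (h x / r)) = V (\<lambda>x. (2 * d / r) * (h x / d))" using d by simp
    also have "\<dots> \<le> ennreal (L * (2 * d / r)) * V (\<lambda>x. h x / d)"
      using d r \<open>2 * d \<le> r\<close> by (intro V_scale) auto
    also have "\<dots> \<le> ennreal (L * (2 * d / r)) * 1"
      using d by (intro mult_left_mono) auto
    finally show ?thesis by simp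
  qed
  have "V (\<lambda>x. f x / r + g x / r) \<le> ennreal (L * (2 * s / r)) + ennreal (L * (2 * t / r))"
    using assms by (intro order_trans[OF V_add] add_mono *) auto
  also have "\<dots> = ennreal (L * (2 * s / r) + L * (2 * t / r))"
    using assms r L_ge_1 by (intro ennreal_plus[symmetric]) auto
  also have "L * (2 * s / r) + L * (2 * t / r) = r / r"
    unfolding r_def by (simp add: add_divide_distrib[symmetric] algebra_simps)
  finally have "V (\<lambda>x. (f x + g x) / r) \<le> 1" using r by (simp add: add_divide_distrib)
  then show ?thesis unfolding r_def .
qed

lemma RBV_add:
  assumes "f \<in> RBV \<phi> I" "g \<in> RBV \<phi> I"
  shows "(\<lambda>x. f x + g x) \<in> RBV \<phi> I"
proof -
  obtain s t where st: "0 < s" "V (\<lambda>x. f x / s) \<le> 1" "0 < t" "V (\<lambda>x. g x / t) \<le> 1"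
    using assms by (auto simp: RBV_iff)
  moreover have "0 < 2 * L * (s + t)" using st L_ge_1 by simp
  ultimately show ?thesis
    using V_add_quotient[of s t f g] assms unfolding RBV_iff
    by (intro conjI exI[of _ "2 * L * (s + t)"]) auto
qed

lemma RBV_diff:
  assumes "f \<in> RBV \<phi> I" "g \<in> RBV \<phi> I"
  shows "(\<lambda>x. f x - g x) \<in> RBV \<phi> I"
  using RBV_add[OF assms(1) RBV_scale[OF assms(2), of "- 1"]] by simp

lemma RBV_norm_add:
  assumes "f \<in> RBV \<phi> I" "g \<in> RBV \<phi> I"
  shows "N (\<lambda>x. f x + g x) \<le> 2 * L * (N f + N g)"
proof (rule field_le_epsilon)
  fix e :: real assume e: "0 < e"
  \<comment> \<open>The slack \<open>d\<close> occurs twice and is multiplied by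
    \<open>2 * L\<close>, which gives \<open>e\<close> in total.\<close>
  define d where "d = e / (4 * L)"
  have d: "0 < d" using e L_ge_1 by (simp add: d_def)
  have "0 < N f + d" "0 < N g + d"
    using d assms by (auto intro: add_nonneg_pos RBV_norm_nonneg)
  moreover from this have "0 < 2 * L * ((N f + d) + (N g + d))" using L_ge_1 by simp
  ultimately have "N (\<lambda>x. f x + g x) \<le> 2 * L * ((N f + d) + (N g + d))"
    using d assms by (intro RBV_norm_le V_add_quotient RBV_norm_less) auto
  also have "\<dots> = 2 * L * (N f + N g) + e"
    using L_ge_1 by (simp add: d_def field_simps)
  finally show "N (\<lambda>x. f x + g x) \<le> 2 * L * (N f + N g) + e" .
qed

end

section \<open>Pointwise control by the quasi-norm\<close>

lemma initial_interval_partition: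
  fixes a b y :: real
  assumes "a < y" "y \<le> b"
  obtains P where "P \<in> interval_partitions {a..b}" "{a..y} \<in> P"
\<comment> \<open>For \<open>y = b\<close> the remaining interval \<open>{y..b}\<close> would be
  degenerate.\<close>
proof (cases "y = b")
  case True
  have "{{a..b}} \<in> interval_partitions {a..b}"
    using assms division_of_self[of a b] unfolding interval_partitions_def by auto
  then show thesis using that True by blast
next
  case False
  have "{{a..y}} \<union> {{y..b}} division_of {a..y} \<union> {y..b}"
    using assms division_of_self[of a y] division_of_self[of y b]
    by (intro division_disjoint_union) auto
  moreover have "{a..y} \<union> {y..b} = {a..b}" using assms by auto
  ultimately have "{{a..y}, {y..b}} \<in> interval_partitions {a..b}"
    using assms False unfolding interval_partitions_def by (auto simp: insert_commute)
  then show thesis using that by blast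
qed

text \<open>If \<open>h y\<close> were too large compared with \<open>e\<close>, the interval
  \<open>{a..y}\<close> alone would contribute more than 1 to the variation of \<open>h / e\<close>.
  The bound \<open>T\<close> may depend on \<open>y\<close> but not on \<open>h\<close> or
  \<open>e\<close>; this uniformity gives both definiteness and pointwise Cauchy sequences.\<close>

lemma (in weak_Phi) pointwise_bound:
  assumes I: "I = {a..b}" and y: "y \<in> I"
  obtains T where "0 < T"
    "\<And>h e. \<lbrakk>h a = 0; 0 < e; V (\<lambda>x. h x / e) \<le> 1\<rbrakk> \<Longrightarrow> \<bar>h y\<bar> \<le> e * T"
proof (cases "y = a")
  case True
  then show thesis using that[of 1] by auto
next
  case False
  then have ay: "a < y" "y \<le> b" "a \<in> I" using I y by auto
  have "\<forall>\<^sub>F t in at_top. ennreal (1 / (y - a)) < \<phi> a t"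
    \<comment> \<open>The threshold \<open>1 / (y - a)\<close> becomes 1 after multiplication by the
      length of \<open>{a..y}\<close>.\<close>
    using at_top[OF \<open>a \<in> I\<close>] by (rule order_tendstoD) simp
  then have "\<forall>\<^sub>F t in at_top. 0 < t \<and> ennreal (1 / (y - a)) < \<phi> a t"
    using eventually_gt_at_top[of 0] by eventually_elim simp
  then obtain t where t: "0 < t" "ennreal (1 / (y - a)) < \<phi> a t"
    by (auto dest: eventually_happens)
  obtain P where P: "P \<in> interval_partitions I" "{a..y} \<in> P"
    using initial_interval_partition[of a y b] ay I by blast
  show thesis
  proof (rule that[of "t * (y - a)"])
    show "0 < t * (y - a)" using t ay by simp
    fix h :: "real \<Rightarrow> real" and e :: real
    assume h: "h a = 0" and e: "0 < e" and "V (\<lambda>x. h x / e) \<le> 1"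
    show "\<bar>h y\<bar> \<le> e * (t * (y - a))"
    proof (rule ccontr)
      assume "\<not> ?thesis"
      \<comment> \<open>Since \<open>h a = 0\<close>, the right-hand side is the absolute difference
        quotient of \<open>h / e\<close> over \<open>{a..y}\<close>.\<close>
      then have le: "t \<le> \<bar>h y / e\<bar> / (y - a)"
        using e ay by (simp add: field_simps)
      have "1 = ennreal (1 / (y - a)) * ennreal (y - a)"
        using ay by (simp flip: ennreal_mult)
      also have "\<dots> < \<phi> a t * ennreal (y - a)"
        using t ay by (intro ennreal_mult_strict_right_mono) auto
      \<comment> \<open>The supremum over \<open>{a..y}\<close> is bounded below by the value at
        \<open>a\<close>, the point for which \<open>t\<close> was chosen.\<close>
      also have "\<dots> \<le> phi_sup \<phi> {a..y} (\<bar>h y / e\<bar> / (y - a)) * ennreal (y - a)"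
        unfolding phi_sup_def using ay t le
        by (intro mult_right_mono SUP_upper2[of a] mono) auto
      also have "\<dots> = summand (\<lambda>x. h x / e) {a..y}"
        using ay h by (simp add: summand_def)
      also have "\<dots> \<le> (\<Sum>K\<in>P. summand (\<lambda>x. h x / e) K)"
        using P interval_partitionsD(1) by (intro member_le_sum) auto
      also have "\<dots> \<le> V (\<lambda>x. h x / e)" by (rule V_upper) fact
      finally show False using \<open>V (\<lambda>x. h x / e) \<le> 1\<close> by simp
    qed
  qed
qed

section \<open>Quasi-norm axioms and completeness of \<open>RBV0\<close>\<close>

theorem theorem4p4:
  fixes a b :: real and \<phi> :: "real \<Rightarrow> real \<Rightarrow> ennreal"
  assumes "a < b"
    and "\<phi> \<in> Phi_w {a..b}"
  shows "quasi_Banach_space (\<lambda>(c::real) (f::real \<Rightarrow> real) x. c * f x)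
           (RBV0 \<phi> a b) (RBV_norm \<phi> {a..b})"
proof -
  define I where "I = {a..b}"
  obtain L where "weak_Phi \<phi> {a..b} L"
    using assms(2) by (rule Phi_w_imp_weak_Phi)
  then interpret weak_Phi \<phi> I L unfolding I_def .
  interpret vs: vector_space "\<lambda>(c::real) (f::real \<Rightarrow> real) x. c * f x"
    by unfold_locales (auto simp: algebra_simps)
  have mem: "f \<in> RBV0 \<phi> a b \<longleftrightarrow> f \<in> RBV \<phi> I \<and> f a = 0" for f
    by (simp add: RBV0_def I_def)
  have zero_mem: "0 \<in> RBV \<phi> I"
    by (auto simp: RBV_iff V_zero intro!: exI[of _ 1])
  have diff_mem: "f - g \<in> RBV \<phi> I" if "f \<in> RBV \<phi> I" "g \<in> RBV \<phi> I" for f g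
    using RBV_diff[OF that] by (simp add: fun_diff_def)
  have "quasi_Banach_space (\<lambda>(c::real) (f::real \<Rightarrow> real) x. c * f x) (RBV0 \<phi> a b) N"
  proof
    show "vs.subspace (RBV0 \<phi> a b)"
      unfolding vs.subspace_def using RBV_add RBV_scale zero_mem
      by (auto simp: mem plus_fun_def)
  next
    fix f assume "f \<in> RBV0 \<phi> a b"
    then show "0 \<le> N f" by (simp add: mem RBV_norm_nonneg)
  next
    fix f assume f: "f \<in> RBV0 \<phi> a b"
    show "N f = 0 \<longleftrightarrow> f = 0"
    proof
      assume "N f = 0"
      have "f y = 0" for y
      proof (cases "y \<in> I")
        case True
        obtain T where T: "0 < T"
          "\<And>h e. \<lbrakk>h a = 0; 0 < e; V (\<lambda>x. h x / e) \<le> 1\<rbrakk> \<Longrightarrow> \<bar>h y\<bar> \<le> e * T"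
          using pointwise_bound[OF I_def True] by blast
        \<comment> \<open>The scale \<open>e / T\<close> lies strictly above \<open>N f = 0\<close>
          and cancels the \<open>T\<close> of the pointwise bound.\<close>
        have "\<bar>f y\<bar> \<le> 0 + e" if "0 < e" for e
          using T(2)[of f "e / T"] RBV_norm_less[of f "e / T"] T(1) f that \<open>N f = 0\<close>
          by (simp add: mem)
        then have "\<bar>f y\<bar> \<le> 0" by (rule field_le_epsilon)
        then show ?thesis by simp
      qed (use f in \<open>auto simp: mem RBV_iff\<close>)
      then show "f = 0" by auto
    next
      assume "f = 0"
      then show "N f = 0" using RBV_norm_zero by (simp add: zero_fun_def)
    qed
  next
    fix f c assume "f \<in> RBV0 \<phi> a b"
    then show "N (\<lambda>x. c * f x) = \<bar>c\<bar> * N f" by (simp add: mem RBV_norm_scale)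
  next
    show "\<exists>C. \<forall>f\<in>RBV0 \<phi> a b. \<forall>g\<in>RBV0 \<phi> a b. N (f + g) \<le> C * (N f + N g)"
      using RBV_norm_add by (auto simp: mem plus_fun_def intro!: exI[of _ "2 * L"])
  next
    fix u :: "nat \<Rightarrow> real \<Rightarrow> real"
    assume u: "\<And>n. u n \<in> RBV0 \<phi> a b"
      and cauchy: "\<forall>e>0. \<exists>M. \<forall>m\<ge>M. \<forall>n\<ge>M. N (u m - u n) < e"
    \<comment> \<open>Restates the Cauchy condition through \<open>V\<close>, the form suited to
      pointwise bounds and limits.\<close>
    have V_diff: "\<exists>M. \<forall>m\<ge>M. \<forall>n\<ge>M. V (\<lambda>x. (u m x - u n x) / e) \<le> 1" if e: "0 < e" for e
    proof -
      obtain M where "\<forall>m\<ge>M. \<forall>n\<ge>M. N (u m - u n) < e" using cauchy e by blast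
      then have "\<forall>m\<ge>M. \<forall>n\<ge>M. V (\<lambda>x. (u m - u n) x / e) \<le> 1"
        using u by (intro allI impI RBV_norm_less diff_mem) (auto simp: mem fun_diff_def)
      then show ?thesis by auto
    qed
    have "convergent (\<lambda>n. u n y)" for y
    proof (cases "y \<in> I")
      case True
      obtain T where T: "0 < T"
        "\<And>h e. \<lbrakk>h a = 0; 0 < e; V (\<lambda>x. h x / e) \<le> 1\<rbrakk> \<Longrightarrow> \<bar>h y\<bar> \<le> e * T"
        using pointwise_bound[OF I_def True] by blast
      have "Cauchy (\<lambda>n. u n y)"
      proof (rule metric_CauchyI)
        fix e :: real assume "0 < e"
        \<comment> \<open>The pointwise bound turns this scale into \<open>e / 2\<close>, leaving
          room for a strict inequality.\<close>
        then have e: "0 < e / (2 * T)" using T by simp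
        obtain M where M: "\<forall>m\<ge>M. \<forall>n\<ge>M. V (\<lambda>x. (u m x - u n x) / (e / (2 * T))) \<le> 1"
          using V_diff[OF e] by blast
        have "dist (u m y) (u n y) < e" if "m \<ge> M" "n \<ge> M" for m n
        proof -
          have "\<bar>u m y - u n y\<bar> \<le> e / (2 * T) * T"
            using M that u e by (intro T(2)) (auto simp: mem)
          then show ?thesis using T \<open>0 < e\<close> by (simp add: dist_real_def)
        qed
        then show "\<exists>M. \<forall>m\<ge>M. \<forall>n\<ge>M. dist (u m y) (u n y) < e" by blast
      qed
      then show ?thesis by (rule Cauchy_convergent)
    next
      case False
      then have "(\<lambda>n. u n y) = (\<lambda>n. 0)" using u by (auto simp: mem RBV_iff)
      then show ?thesis by (simp add: convergent_const)
    qed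
    then obtain l where l: "\<And>y. (\<lambda>n. u n y) \<longlonglongrightarrow> l y"
      unfolding convergent_def by metis
    \<comment> \<open>Used both for points outside \<open>I\<close> and for the left endpoint
      \<open>a\<close>.\<close>
    have l_zero: "l y = 0" if "\<And>n. u n y = 0" for y
      using l[of y] that by (simp add: LIMSEQ_const_iff)
    have V_lim: "\<exists>M. \<forall>n\<ge>M. V (\<lambda>x. (u n x - l x) / e) \<le> 1" if e: "0 < e" for e
    proof -
      \<comment> \<open>With \<open>n\<close> fixed, \<open>m\<close> tends to infinity. Starting
        from the scale \<open>e / 2\<close> compensates for the halving in
        \<open>V_half_limit\<close>.\<close>
      obtain M where M: "\<forall>n\<ge>M. \<forall>m\<ge>M. V (\<lambda>x. (u n x - u m x) / (e / 2)) \<le> 1"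
        using V_diff[of "e / 2"] e by auto
      have "V (\<lambda>x. (u n x - l x) / e) \<le> 1" if "n \<ge> M" for n
      proof -
        have "V (\<lambda>x. (u n x - l x) / (e / 2) / 2) \<le> 1"
        proof (rule V_half_limit)
          show "(\<lambda>m. (u n x - u m x) / (e / 2)) \<longlonglongrightarrow> (u n x - l x) / (e / 2)" for x
            using e by (intro tendsto_intros l) auto
          show "\<forall>\<^sub>F m in sequentially. V (\<lambda>x. (u n x - u m x) / (e / 2)) \<le> 1"
            using M that by (auto simp: eventually_sequentially)
        qed
        moreover have "z / (e / 2) / 2 = z / e" for z by simp
        ultimately show ?thesis by (simp only:)
      qed
      then show ?thesis by blast
    qed
    have "l \<in> RBV0 \<phi> a b"
    proof -
      \<comment> \<open>A single \<open>n\<close> at scale 1 suffices: \<open>u n - l\<close> lies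
        in \<open>RBV\<close>, and \<open>l\<close> is recovered as
        \<open>u n - (u n - l)\<close>.\<close>
      obtain n where n: "V (\<lambda>x. (u n x - l x) / 1) \<le> 1" using V_lim[of 1] by auto
      have "(\<lambda>x. u n x - l x) \<in> RBV \<phi> I"
        unfolding RBV_iff
      proof (intro conjI allI impI exI[of _ 1])
        show "u n x - l x = 0" if "x \<notin> I" for x
          using u that l_zero[of x] by (simp add: mem RBV_iff)
      qed (use n in auto)
      then have "l \<in> RBV \<phi> I"
        using RBV_diff[of "u n" "\<lambda>x. u n x - l x"] u by (simp add: mem)
      then show ?thesis using u l_zero[of a] by (simp add: mem)
    qed
    moreover have "(\<lambda>n. N (u n - l)) \<longlonglongrightarrow> 0"
    proof (rule LIMSEQ_I)
      fix e :: real assume "0 < e"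
      \<comment> \<open>\<open>RBV_norm_le\<close> yields only a non-strict bound, so
        \<open>e / 2\<close> is used to stay below \<open>e\<close>.\<close>
      then obtain M where M: "\<forall>n\<ge>M. V (\<lambda>x. (u n x - l x) / (e / 2)) \<le> 1"
        using V_lim[of "e / 2"] by auto
      have "norm (N (u n - l) - 0) < e" if "n \<ge> M" for n
      proof -
        have "N (u n - l) \<le> e / 2"
          using M that \<open>0 < e\<close> by (intro RBV_norm_le) auto
        moreover have "0 \<le> N (u n - l)"
          using u \<open>l \<in> RBV0 \<phi> a b\<close> by (intro RBV_norm_nonneg diff_mem) (auto simp: mem)
        ultimately show ?thesis using \<open>0 < e\<close> by simp
      qed
      then show "\<exists>M. \<forall>n\<ge>M. norm (N (u n - l) - 0) < e" by blast
    qed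
    ultimately show "\<exists>l\<in>RBV0 \<phi> a b. (\<lambda>n. N (u n - l)) \<longlonglongrightarrow> 0" by blast
  qed
  then show ?thesis by (simp add: I_def)
qed

end
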